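(* Let $n\ge 3$ and let $l_1,\dots,l_n$ be positive integers. Let $G$ be an $n$-gear with lengths $(l_1,\dots,l_n)$ and let $\tilde G$ be its dual $n$-gear. Then for every weight $w>0$, the Markov matrices $M$ of $G$ and $\tilde M$ of $\tilde G$ are isospectral, i.e. they have the same eigenvalues, including multiplicities.
   Context: An $n$-gear with lengths $(l_1,\dots,l_n)$ is a metric graph with $2n$ vertices comprised of a polygon (cycle) with $n$ sides $p_1,\dots,p_n$ of lengths $l_1,\dots,l_n$, together with $n$ leaf edges $t_1,\dots,t_n$ of lengths $l_1,\dots,l_n$, called teeth, such that the $i$th tooth $t_i$ is attached at one of the two end vertices of the $i$th polygon side $p_i$, its other end being a leaf vertex (of degree 1). The dual $n$-gear is obtained by attaching each tooth $t_i$ at the other end vertex of its corresponding polygon side $p_i$ instead. If all lengths are positive integers, the subdivided $n$-gear is the combinatorial graph obtained by replacing each edge (polygon side or tooth) of length $l_i$ by a path of $l_i$ edges of length $1$; it has $2(l_1+\dots+l_n)$ vertices. Each edge of the subdivided graph belongs either to the polygon or to a tooth. For a weight $w>0$, the Markov matrix $M$ of the $n$-gear is the row-stochastic matrix of the random walk on the vertices of the subdivided $n$-gear in which edges belonging to teeth are taken $w$ times as likely as edges belonging to the polygon. That is, for a function $f$ on the vertices and a vertex $v$, with $P$ the set of neighbors of $v$ joined to $v$ by an edge belonging to the polygon and $T$ the set of neighbors of $v$ joined to $v$ by an edge belonging to a tooth, $$M[f](v)=\frac{1}{|P|+w|T|}\Bigl(\sum_{v'\in P}f(v')+\sum_{v'\in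 T}w\,f(v')\Bigr).$$ *)

theory Defs
  imports
    "Graph_Theory.Digraph"
    "Jordan_Normal_Form.Spectral_Radius"
    "HOL-Library.Indicator_Function"
begin

text \<open>
  An undirected metric multigraph is represented by a \<^typ>\<open>('v, 'e) pre_digraph\<close>
  with a length for each edge. Choosing one end of an edge as its tail is only a
  parametrisation: the edges of the subdivision are unordered pairs.
\<close>

record ('v, 'e) metric_graph = "('v, 'e) pre_digraph" +
  len :: "'e \<Rightarrow> nat"

datatype ('v, 'e) point = Vertex 'v | Inner 'e nat

text \<open>The point at distance \<open>k\<close> from the tail of the edge \<open>e\<close>, for \<open>k \<le> len G e\<close>.\<close>

definition point_at :: "('v, 'e) metric_graph \<Rightarrow> 'e \<Rightarrow> nat \<Rightarrow> ('v, 'e) point" where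
  "point_at G e k =
    (if k = 0 then Vertex (tail G e)
     else if k = len G e then Vertex (head G e)
     else Inner e k)"

definition subdiv_verts :: "('v, 'e) metric_graph \<Rightarrow> ('v, 'e) point set" where
  "subdiv_verts G =
    Vertex ` verts G \<union> {Inner e k | e k. e \<in> arcs G \<and> 0 < k \<and> k < len G e}"

definition unit_edges :: "('v, 'e) metric_graph \<Rightarrow> 'e \<Rightarrow> ('v, 'e) point set set" where
  "unit_edges G e = {{point_at G e k, point_at G e (Suc k)} | k. k < len G e}"


datatype gear_vertex = Corner nat | Leaf nat
datatype gear_edge = is_side: Side nat | is_tooth: Tooth nat

text \<open>
  Indices run over \<open>0, \<dots>, n - 1\<close>; side \<open>i\<close> joins corner \<open>i\<close> to corner \<open>i + 1\<close> (cyclically).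
  The function \<open>a\<close> records the attachments: tooth \<open>i\<close> sits at corner \<open>i + 1\<close> if \<open>a i\<close>, and
  at corner \<open>i\<close> otherwise. Two teeth may share a corner.
\<close>

fun gear_tail :: "nat \<Rightarrow> (nat \<Rightarrow> bool) \<Rightarrow> gear_edge \<Rightarrow> gear_vertex" where
  "gear_tail n a (Side i) = Corner i"
| "gear_tail n a (Tooth i) = Corner (if a i then Suc i mod n else i)"

fun gear_head :: "nat \<Rightarrow> gear_edge \<Rightarrow> gear_vertex" where
  "gear_head n (Side i) = Corner (Suc i mod n)"
| "gear_head n (Tooth i) = Leaf i"

fun gear_len :: "(nat \<Rightarrow> nat) \<Rightarrow> gear_edge \<Rightarrow> nat" where
  "gear_len l (Side i) = l i"
| "gear_len l (Tooth i) = l i"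

definition gear ::
  "nat \<Rightarrow> (nat \<Rightarrow> nat) \<Rightarrow> (nat \<Rightarrow> bool) \<Rightarrow> (gear_vertex, gear_edge) metric_graph" where
  "gear n l a =
    \<lparr> verts = Corner ` {..<n} \<union> Leaf ` {..<n},
      arcs = Side ` {..<n} \<union> Tooth ` {..<n},
      tail = gear_tail n a,
      head = gear_head n,
      len = gear_len l \<rparr>"

definition dual_gear ::
  "nat \<Rightarrow> (nat \<Rightarrow> nat) \<Rightarrow> (nat \<Rightarrow> bool) \<Rightarrow> (gear_vertex, gear_edge) metric_graph" where
  "dual_gear n l a = gear n l (\<lambda>i. \<not> a i)"


type_synonym gear_point = "(gear_vertex, gear_edge) point"

definition polygon_nbrs ::
  "(gear_vertex, gear_edge) metric_graph \<Rightarrow> gear_point \<Rightarrow> gear_point set" where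
  "polygon_nbrs G v = {v'. \<exists>e\<in>arcs G. is_side e \<and> {v, v'} \<in> unit_edges G e}"

definition tooth_nbrs ::
  "(gear_vertex, gear_edge) metric_graph \<Rightarrow> gear_point \<Rightarrow> gear_point set" where
  "tooth_nbrs G v = {v'. \<exists>e\<in>arcs G. is_tooth e \<and> {v, v'} \<in> unit_edges G e}"

definition markov_op ::
  "(gear_vertex, gear_edge) metric_graph \<Rightarrow> real \<Rightarrow> (gear_point \<Rightarrow> real) \<Rightarrow> gear_point \<Rightarrow> real" where
  "markov_op G w f v =
    1 / (real (card (polygon_nbrs G v)) + w * real (card (tooth_nbrs G v))) *
      ((\<Sum>v'\<in>polygon_nbrs G v. f v') + (\<Sum>v'\<in>tooth_nbrs G v. w * f v'))"

definition enumerates :: "'a list \<Rightarrow> 'a set \<Rightarrow> bool" where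
  "enumerates xs A \<longleftrightarrow> distinct xs \<and> set xs = A"

text \<open>
  The matrix of the Markov operator in the basis of indicator functions, with rows and
  columns ordered by a list \<open>vs\<close> that enumerates the vertices of the subdivision.
\<close>

definition markov_matrix ::
  "(gear_vertex, gear_edge) metric_graph \<Rightarrow> real \<Rightarrow> gear_point list \<Rightarrow> real mat" where
  "markov_matrix G w vs =
    mat (length vs) (length vs) (\<lambda>(i, j). markov_op G w (indicator {vs ! j}) (vs ! i))"


text \<open>Eigenvalues are taken in the complex numbers and counted with algebraic multiplicity.\<close>

definition isospectral :: "real mat \<Rightarrow> real mat \<Rightarrow> bool" where
  "isospectral A B \<longleftrightarrow>
    (let A' = map_mat complex_of_real A; B' = map_mat complex_of_real B in
      spectrum A' = spectrum B' \<and>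
      (\<forall>x\<in>spectrum A'. order x (char_poly A') = order x (char_poly B')))"

end

theory Submission
  imports Defs
begin

text \<open>
  Lay tooth \<open>i\<close> parallel to side \<open>i\<close>, glued to it at the corner they share. For a function \<open>f\<close> with
  values \<open>s\<close> on the side and \<open>r\<close> on the parallel tooth, put \<open>s' + w r'\<close> on the side and
  \<open>s' - r'\<close> on the parallel tooth of the dual gear, where the prime is the symmetric
  difference. The leaf condition \<open>r' = 0\<close> and the balance of slopes at the corners make this a
  well-defined function on the dual gear, and the resulting map \<open>T\<close> satisfies \<open>N T = T M\<close> for the
  two Markov operators \<open>M\<close> and \<open>N\<close>. With the analogous map \<open>S\<close> of the dual gear one gets
  \<open>S T = 4 (1 + w) (M\<^sup>2 - 1)\<close> and \<open>T S = 4 (1 + w) (N\<^sup>2 - 1)\<close>. Neither map is invertible, but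
  cyclicity of the trace gives \<open>tr M\<^bsup>k+2\<^esup> - tr M\<^sup>k = tr N\<^bsup>k+2\<^esup> - tr N\<^sup>k\<close>. Since \<open>tr M = tr N = 0\<close>
  and the sizes agree, all power traces agree, hence so do the characteristic polynomials.
\<close>

subsection \<open>Traces of powers determine the spectrum\<close>

definition mat_trace :: "'a::comm_monoid_add mat \<Rightarrow> 'a" where
  "mat_trace A = (\<Sum>i<dim_row A. A $$ (i, i))"

lemma mat_trace_mult_commute:
  fixes A B :: "'a::comm_semiring_0 mat"
  assumes "A \<in> carrier_mat n m" "B \<in> carrier_mat m n"
  shows "mat_trace (A * B) = mat_trace (B * A)"
proof -
  have "mat_trace (A * B) = (\<Sum>i<n. \<Sum>k<m. A $$ (i, k) * B $$ (k, i))"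
    using assms by (auto simp: mat_trace_def scalar_prod_def lessThan_atLeast0 intro!: sum.cong)
  also have "\<dots> = (\<Sum>k<m. \<Sum>i<n. B $$ (k, i) * A $$ (i, k))"
    by (subst sum.swap) (simp add: mult.commute)
  also have "\<dots> = mat_trace (B * A)"
    using assms by (auto simp: mat_trace_def scalar_prod_def lessThan_atLeast0 intro!: sum.cong)
  finally show ?thesis .
qed

lemma mat_trace_minus:
  fixes A B :: "'a::ab_group_add mat"
  assumes "A \<in> carrier_mat n n" "B \<in> carrier_mat n n"
  shows "mat_trace (A - B) = mat_trace A - mat_trace B"
  using assms by (auto simp: mat_trace_def sum_subtractf)

lemma mat_trace_smult:
  fixes A :: "'a::semiring_0 mat"
  assumes "A \<in> carrier_mat n n"
  shows "mat_trace (c \<cdot>\<^sub>m A) = c * mat_trace A"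
  using assms by (auto simp: mat_trace_def sum_distrib_left)

lemma mat_trace_similar_wit:
  fixes A B :: "'a::comm_ring_1 mat"
  assumes A: "A \<in> carrier_mat n n" and wit: "similar_mat_wit A B P Q"
  shows "mat_trace A = mat_trace B"
proof -
  note w = similar_mat_witD2[OF A wit]
  have "mat_trace A = mat_trace (P * (B * Q))"
    using w by (simp add: assoc_mult_mat[of P n n B n Q n])
  also have "\<dots> = mat_trace ((B * Q) * P)"
    by (rule mat_trace_mult_commute[of _ n n]) (use w in auto)
  also have "(B * Q) * P = B"
    using w by (simp add: assoc_mult_mat[of B n n Q n P n])
  finally show ?thesis .
qed

text \<open>A term \<open>A $$ (i, k) * B $$ (k, j)\<close> can be nonzero only for
  \<open>i \<le> k \<le> j\<close>: no such \<open>k\<close> exists below the diagonal, and only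
  \<open>k = i\<close> on it.\<close>

lemma upper_triangular_mult:
  fixes A B :: "'a::comm_semiring_0 mat"
  assumes A: "A \<in> carrier_mat n n" "upper_triangular A"
    and B: "B \<in> carrier_mat n n" "upper_triangular B"
  shows "upper_triangular (A * B)"
    and "i < n \<Longrightarrow> (A * B) $$ (i, i) = A $$ (i, i) * B $$ (i, i)"
proof -
  have entry: "(A * B) $$ (i, j) = (\<Sum>k<n. A $$ (i, k) * B $$ (k, j))" if "i < n" "j < n" for i j
    using A B that by (auto simp: scalar_prod_def lessThan_atLeast0 intro!: sum.cong)
  have zero: "A $$ (i, k) * B $$ (k, j) = 0" if "i < n" "k < n" "k < i \<or> j < k" for i j k
    using upper_triangularD[OF A(2), of k i] upper_triangularD[OF B(2), of j k] A B that by auto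
  show "upper_triangular (A * B)"
  proof (rule upper_triangularI)
    fix i j assume ij: "j < i" "i < dim_row (A * B)"
    then have "i < n" "j < n" using A by auto
    then show "(A * B) $$ (i, j) = 0"
      unfolding entry[OF \<open>i < n\<close> \<open>j < n\<close>] using ij by (intro sum.neutral ballI zero) auto
  qed
  show "(A * B) $$ (i, i) = A $$ (i, i) * B $$ (i, i)" if i: "i < n"
  proof -
    have "(A * B) $$ (i, i) = (\<Sum>k\<in>{i}. A $$ (i, k) * B $$ (k, i))"
      unfolding entry[OF i i] using i
      by (intro sum.mono_neutral_right) (auto intro!: zero simp: nat_neq_iff)
    then show ?thesis by simp
  qed
qed

lemma upper_triangular_pow:
  fixes A :: "'a::comm_semiring_1 mat"
  assumes A: "A \<in> carrier_mat n n" "upper_triangular A"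
  shows "upper_triangular (A ^\<^sub>m k) \<and> (\<forall>i<n. (A ^\<^sub>m k) $$ (i, i) = A $$ (i, i) ^ k)"
proof (induction k)
  case 0
  then show ?case using A by auto
next
  case (Suc k)
  have "A ^\<^sub>m k \<in> carrier_mat n n" using A by simp
  then show ?case
    using upper_triangular_mult[of "A ^\<^sub>m k" n A] Suc A by (simp add: mult.commute)
qed

text \<open>Schur triangularisation puts the eigenvalues on the diagonal of a similar triangular
  matrix. Powers of that matrix have the powered eigenvalues on their diagonal, and the trace is
  invariant under similarity.\<close>

lemma mat_trace_pow_eq_sum_list:
  fixes A :: "complex mat"
  assumes A: "A \<in> carrier_mat n n"
    and cp: "char_poly A = (\<Prod>x\<leftarrow>xs. [:- x, 1:])"
  shows "mat_trace (A ^\<^sub>m k) = (\<Sum>x\<leftarrow>xs. x ^ k)"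
proof -
  obtain B P Q where sd: "schur_decomposition A xs = (B, P, Q)"
    by (cases "schur_decomposition A xs") auto
  from schur_decomposition[OF A cp sd]
  have wit: "similar_mat_wit A B P Q" and ut: "upper_triangular B" and diag: "diag_mat B = xs"
    by auto
  have B: "B \<in> carrier_mat n n" using similar_mat_witD2[OF A wit] by auto
  have "mat_trace (A ^\<^sub>m k) = mat_trace (B ^\<^sub>m k)"
    by (rule mat_trace_similar_wit[OF _ similar_mat_wit_pow[OF wit]]) (use A in auto)
  also have "\<dots> = (\<Sum>i<n. B $$ (i, i) ^ k)"
    using upper_triangular_pow[OF B ut, of k] B by (auto simp: mat_trace_def)
  also have "\<dots> = (\<Sum>x\<leftarrow>xs. x ^ k)"
    using B by (simp add: diag[symmetric] diag_mat_def sum_list_sum_nth lessThan_atLeast0)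
  finally show ?thesis .
qed

text \<open>Equal power sums give equal sums of values of every polynomial. A polynomial vanishing
  at every listed number except \<open>z\<close> turns such a sum into the multiplicity of
  \<open>z\<close>, up to a nonzero factor.\<close>

lemma mset_eq_of_power_sums_eq:
  fixes xs ys :: "'a::field_char_0 list"
  assumes pow: "\<And>k. (\<Sum>x\<leftarrow>xs. x ^ k) = (\<Sum>x\<leftarrow>ys. x ^ k)"
  shows "mset xs = mset ys"
proof (rule multiset_eqI)
  fix z
  define p where "p = (\<Prod>y\<in>set xs \<union> set ys - {z}. [:- y, 1:])"
  have poly_sum: "(\<Sum>x\<leftarrow>zs. poly p x) = (\<Sum>i\<le>degree p. coeff p i * (\<Sum>x\<leftarrow>zs. x ^ i))" for zs
  proof (induction zs)
    case (Cons a zs)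
    then show ?case by (simp add: poly_altdef distrib_left sum.distrib)
  qed simp
  have pz: "poly p z \<noteq> 0"
    by (auto simp: p_def poly_prod)
  have p0: "poly p x = 0" if "x \<in> set xs \<union> set ys" "x \<noteq> z" for x
    using that by (auto simp: p_def poly_prod intro!: prod_zero bexI[of _ x])
  have count: "(\<Sum>x\<leftarrow>zs. poly p x) = of_nat (count (mset zs) z) * poly p z"
    if "set zs \<subseteq> set xs \<union> set ys" for zs
    using that
  proof (induction zs)
    case (Cons a zs)
    then show ?case using p0[of a] by (cases "a = z") (auto simp: distrib_right)
  qed simp
  have "(\<Sum>x\<leftarrow>xs. poly p x) = (\<Sum>x\<leftarrow>ys. poly p x)"
    by (simp add: poly_sum pow)
  then show "count (mset xs) z = count (mset ys) z"
    using pz by (simp add: count)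
qed

lemma char_poly_eq_of_mat_trace_pow_eq:
  fixes A B :: "complex mat"
  assumes A: "A \<in> carrier_mat n n" and B: "B \<in> carrier_mat n n"
    and tr: "\<And>k. mat_trace (A ^\<^sub>m k) = mat_trace (B ^\<^sub>m k)"
  shows "char_poly A = char_poly B"
proof -
  obtain xs ys where xs: "char_poly A = (\<Prod>x\<leftarrow>xs. [:- x, 1:])"
    and ys: "char_poly B = (\<Prod>x\<leftarrow>ys. [:- x, 1:])"
    using char_poly_factorized[OF A] char_poly_factorized[OF B] by auto
  have "mset xs = mset ys"
    by (rule mset_eq_of_power_sums_eq)
      (use tr in \<open>simp add: mat_trace_pow_eq_sum_list[OF A xs] mat_trace_pow_eq_sum_list[OF B ys]\<close>)
  then have "mset (map (\<lambda>x. [:- x, 1:]) xs) = mset (map (\<lambda>x. [:- x, 1:]) ys)"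
    by simp
  then show ?thesis
    unfolding xs ys by (metis prod_mset_prod_list)
qed

lemma isospectral_of_mat_trace_pow_eq:
  fixes A B :: "real mat"
  assumes A: "A \<in> carrier_mat n n" and B: "B \<in> carrier_mat n n"
    and tr: "\<And>k. mat_trace (A ^\<^sub>m k) = mat_trace (B ^\<^sub>m k)"
  shows "isospectral A B"
proof -
  have hom: "mat_trace (map_mat complex_of_real M ^\<^sub>m k) = complex_of_real (mat_trace (M ^\<^sub>m k))"
    if "M \<in> carrier_mat n n" for M k
    using that by (simp add: of_real_hom.mat_hom_pow[symmetric, of M n] mat_trace_def)
  have "char_poly (map_mat complex_of_real A) = char_poly (map_mat complex_of_real B)"
    by (rule char_poly_eq_of_mat_trace_pow_eq[of _ n]) (use A B tr in \<open>auto simp: hom\<close>)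
  moreover have "map_mat complex_of_real A \<in> carrier_mat n n" "map_mat complex_of_real B \<in> carrier_mat n n"
    using A B by auto
  ultimately show ?thesis
    by (simp add: isospectral_def Let_def spectrum_root_char_poly[of _ n])
qed

text \<open>\<open>C\<close> may be singular, so this is not an argument by similarity. The two
  product identities control how the trace changes from the power \<open>k\<close> to
  \<open>k + 2\<close>; the equal sizes and the equal traces start the two-step induction at 0 and
  1.\<close>

lemma mat_trace_pow_eq_of_intertwining:
  fixes A B C C' :: "'a::field mat"
  assumes carr: "A \<in> carrier_mat n n" "B \<in> carrier_mat n n" "C \<in> carrier_mat n n" "C' \<in> carrier_mat n n"
    and inter: "B * C = C * A"
    and C'C: "C' * C = c \<cdot>\<^sub>m (A * A - 1\<^sub>m n)"
    and CC': "C * C' = c \<cdot>\<^sub>m (B * B - 1\<^sub>m n)"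
    and c: "c \<noteq> 0"
    and tr: "mat_trace A = mat_trace B"
  shows "mat_trace (A ^\<^sub>m k) = mat_trace (B ^\<^sub>m k)"
proof -
  have inter_pow: "B ^\<^sub>m k * C = C * A ^\<^sub>m k" for k
  proof (induction k)
    case (Suc k)
    have "B ^\<^sub>m Suc k * C = B ^\<^sub>m k * (B * C)"
      using carr by (simp add: assoc_mult_mat[of _ n n _ n _ n])
    also have "\<dots> = (B ^\<^sub>m k * C) * A"
      using carr by (simp add: inter assoc_mult_mat[of _ n n _ n _ n])
    also have "\<dots> = C * A ^\<^sub>m Suc k"
      using carr by (simp add: Suc assoc_mult_mat[of _ n n _ n _ n])
    finally show ?case .
  qed (use carr in simp)
  have sq: "mat_trace (M ^\<^sub>m k * (c \<cdot>\<^sub>m (M * M - 1\<^sub>m n))) = c * (mat_trace (M ^\<^sub>m Suc (Suc k)) - mat_trace (M ^\<^sub>m k))"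
    if M: "M \<in> carrier_mat n n" for M and k :: nat
  proof -
    have "M ^\<^sub>m k * (c \<cdot>\<^sub>m (M * M - 1\<^sub>m n)) = c \<cdot>\<^sub>m (M ^\<^sub>m k * (M * M - 1\<^sub>m n))"
      using M by (intro mult_smult_distrib[of _ n n _ n]) auto
    also have "M ^\<^sub>m k * (M * M - 1\<^sub>m n) = M ^\<^sub>m k * (M * M) - M ^\<^sub>m k * 1\<^sub>m n"
      using M by (intro mult_minus_distrib_mat[of _ n n _ n]) auto
    also have "\<dots> = M ^\<^sub>m Suc (Suc k) - M ^\<^sub>m k"
      using M by (simp add: assoc_mult_mat[of _ n n _ n _ n])
    finally have eq: "M ^\<^sub>m k * (c \<cdot>\<^sub>m (M * M - 1\<^sub>m n)) = c \<cdot>\<^sub>m (M ^\<^sub>m Suc (Suc k) - M ^\<^sub>m k)" .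
    have carrM: "M ^\<^sub>m Suc (Suc k) \<in> carrier_mat n n" "M ^\<^sub>m k \<in> carrier_mat n n"
      using M by auto
    show ?thesis
      unfolding eq using mat_trace_smult[of _ n c] mat_trace_minus[OF carrM] minus_carrier_mat[OF carrM(2)]
      by metis
  qed
  \<comment> \<open>Cyclicity moves \<open>C\<close> to the front of the product of
    \<open>A ^\<^sub>m k\<close>, \<open>C'\<close> and \<open>C\<close>; intertwining then carries
    it past the power, which turns powers of \<open>A\<close> into powers of
    \<open>B\<close>.\<close>
  have step: "mat_trace (A ^\<^sub>m Suc (Suc k)) - mat_trace (A ^\<^sub>m k) =
      mat_trace (B ^\<^sub>m Suc (Suc k)) - mat_trace (B ^\<^sub>m k)" for k
  proof -
    have "c * (mat_trace (A ^\<^sub>m Suc (Suc k)) - mat_trace (A ^\<^sub>m k)) = mat_trace (A ^\<^sub>m k * (C' * C))"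
      unfolding C'C using sq[OF carr(1)] by simp
    also have "\<dots> = mat_trace ((A ^\<^sub>m k * C') * C)"
      using carr by (simp add: assoc_mult_mat[of _ n n _ n _ n])
    also have "\<dots> = mat_trace (C * (A ^\<^sub>m k * C'))"
      using carr by (intro mat_trace_mult_commute[of _ n n]) auto
    also have "C * (A ^\<^sub>m k * C') = (C * A ^\<^sub>m k) * C'"
      using carr by (simp add: assoc_mult_mat[of _ n n _ n _ n])
    also have "\<dots> = B ^\<^sub>m k * (C * C')"
      using carr by (simp add: inter_pow[symmetric] assoc_mult_mat[of _ n n _ n _ n])
    also have "mat_trace \<dots> = c * (mat_trace (B ^\<^sub>m Suc (Suc k)) - mat_trace (B ^\<^sub>m k))"
      unfolding CC' using sq[OF carr(2)] by simp
    finally show ?thesis using c by simp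
  qed
  show ?thesis
  proof (induction k rule: induct_nat_012)
    case 0
    then show ?case using carr by simp
  next
    case 1
    then show ?case using carr tr by simp
  next
    case (ge2 k)
    then show ?case using step[of k] by simp
  qed
qed

subsection \<open>Matrices of operators on functions\<close>

text \<open>Functions live on the whole point type, whereas matrices see only the finite vertex set.
  For finite \<open>V\<close> this says that the functional is linear and reads only values on
  \<open>V\<close>.\<close>

definition supported_linear :: "'a set \<Rightarrow> (('a \<Rightarrow> real) \<Rightarrow> real) \<Rightarrow> bool" where
  "supported_linear V \<phi> \<longleftrightarrow> (\<forall>f. \<phi> f = (\<Sum>v\<in>V. \<phi> (indicator {v}) * f v))"

lemma supported_linear_eval:
  assumes "finite V" "v \<in> V"
  shows "supported_linear V (\<lambda>f. f v)"
proof -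
  have "(\<Sum>u\<in>V. indicator {u} v * f u) = f v" for f :: "'a \<Rightarrow> real"
    using assms by (subst sum.remove[of _ v]) (auto simp: indicator_def intro!: sum.neutral)
  then show ?thesis by (simp add: supported_linear_def)
qed

lemma supported_linear_zero: "supported_linear V (\<lambda>f. 0)"
  by (simp add: supported_linear_def)

lemma supported_linear_add:
  assumes "supported_linear V \<phi>" "supported_linear V \<psi>"
  shows "supported_linear V (\<lambda>f. \<phi> f + \<psi> f)"
  unfolding supported_linear_def
proof
  fix f
  show "\<phi> f + \<psi> f = (\<Sum>v\<in>V. (\<phi> (indicator {v}) + \<psi> (indicator {v})) * f v)"
    using assms[unfolded supported_linear_def, rule_format, of f]
    by (simp add: distrib_right sum.distrib)
qed

lemma supported_linear_cmult:
  assumes "supported_linear V \<phi>"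
  shows "supported_linear V (\<lambda>f. c * \<phi> f)"
  unfolding supported_linear_def
proof
  fix f
  show "c * \<phi> f = (\<Sum>v\<in>V. c * \<phi> (indicator {v}) * f v)"
    using assms[unfolded supported_linear_def, rule_format, of f]
    by (simp add: sum_distrib_left mult.assoc)
qed

lemma supported_linear_diff:
  assumes "supported_linear V \<phi>" "supported_linear V \<psi>"
  shows "supported_linear V (\<lambda>f. \<phi> f - \<psi> f)"
  using supported_linear_add[OF assms(1) supported_linear_cmult[OF assms(2), of "-1"]] by simp

lemma supported_linear_sum:
  assumes "\<And>x. x \<in> S \<Longrightarrow> supported_linear V (\<phi> x)"
  shows "supported_linear V (\<lambda>f. \<Sum>x\<in>S. \<phi> x f)"
  using assms
proof (induction S rule: infinite_finite_induct)
  case (insert x S)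
  then show ?case by (simp add: supported_linear_add)
qed (simp_all add: supported_linear_zero)

definition op_mat :: "(('a \<Rightarrow> real) \<Rightarrow> 'a \<Rightarrow> real) \<Rightarrow> 'a list \<Rightarrow> 'a list \<Rightarrow> real mat" where
  "op_mat \<Phi> us vs = mat (length us) (length vs) (\<lambda>(i, j). \<Phi> (indicator {vs ! j}) (us ! i))"

lemma op_mat_carrier [simp]: "op_mat \<Phi> us vs \<in> carrier_mat (length us) (length vs)"
  by (simp add: op_mat_def)

lemma op_mat_cong:
  assumes "\<And>f u. u \<in> set us \<Longrightarrow> \<Phi> f u = \<Psi> f u"
  shows "op_mat \<Phi> us vs = op_mat \<Psi> us vs"
  using assms by (auto simp: op_mat_def intro!: eq_matI)

text \<open>Expanding the outer functional in the indicators of \<open>vs\<close> at each row gives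
  the row-by-column product.\<close>

lemma op_mat_mult:
  assumes "distinct vs" and lin: "\<And>u. u \<in> set us \<Longrightarrow> supported_linear (set vs) (\<lambda>f. \<Phi> f u)"
  shows "op_mat \<Phi> us vs * op_mat \<Psi> vs ws = op_mat (\<lambda>f. \<Phi> (\<Psi> f)) us ws"
proof (rule eq_matI)
  fix i k assume "i < dim_row (op_mat (\<lambda>f. \<Phi> (\<Psi> f)) us ws)" "k < dim_col (op_mat (\<lambda>f. \<Phi> (\<Psi> f)) us ws)"
  then have ik: "i < length us" "k < length ws" by (auto simp: op_mat_def)
  let ?g = "\<Psi> (indicator {ws ! k})"
  have "(op_mat \<Phi> us vs * op_mat \<Psi> vs ws) $$ (i, k) =
      (\<Sum>j<length vs. \<Phi> (indicator {vs ! j}) (us ! i) * ?g (vs ! j))"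
    using ik by (auto simp: op_mat_def scalar_prod_def lessThan_atLeast0 intro!: sum.cong)
  also have "\<dots> = (\<Sum>v\<in>set vs. \<Phi> (indicator {v}) (us ! i) * ?g v)"
    by (rule sum.reindex_bij_betw[OF bij_betw_nth[OF assms(1) refl refl]])
  also have "\<dots> = \<Phi> ?g (us ! i)"
    using lin[of "us ! i", unfolded supported_linear_def, THEN spec, of ?g, symmetric] ik by simp
  finally show "(op_mat \<Phi> us vs * op_mat \<Psi> vs ws) $$ (i, k) = op_mat (\<lambda>f. \<Phi> (\<Psi> f)) us ws $$ (i, k)"
    using ik by (simp add: op_mat_def)
qed (auto simp: op_mat_def)

subsection \<open>Slopes along a path\<close>

text \<open>
  The difference \<open>f (\<gamma> (j + 1)) - f (\<gamma> (j - 1))\<close>, where at an end of the path the missing value is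
  the one that would make \<open>M f\<close> the mean of the two neighbouring values there.
\<close>

definition slope :: "(('a \<Rightarrow> real) \<Rightarrow> 'a \<Rightarrow> real) \<Rightarrow> (nat \<Rightarrow> 'a) \<Rightarrow> nat \<Rightarrow> ('a \<Rightarrow> real) \<Rightarrow> nat \<Rightarrow> real" where
  "slope M \<gamma> L f j =
    (if j < L then 2 * (f (\<gamma> (Suc j)) - M f (\<gamma> j)) else 2 * (M f (\<gamma> j) - f (\<gamma> (j - 1))))"

definition averages_along :: "(('a \<Rightarrow> real) \<Rightarrow> 'a \<Rightarrow> real) \<Rightarrow> (nat \<Rightarrow> 'a) \<Rightarrow> nat \<Rightarrow> bool" where
  "averages_along M \<gamma> L \<longleftrightarrow>
    (\<forall>f j. 0 < j \<and> j < L \<longrightarrow> 2 * M f (\<gamma> j) = f (\<gamma> (j - 1)) + f (\<gamma> (Suc j)))"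

text \<open>The forward and backward formulas agree at interior positions, because
  \<open>M f\<close> is the mean of the two neighbouring values there.\<close>

lemma slope_backward:
  assumes "averages_along M \<gamma> L" "0 < j" "j \<le> L"
  shows "slope M \<gamma> L f j = 2 * (M f (\<gamma> j) - f (\<gamma> (j - 1)))"
  using assms(1)[unfolded averages_along_def, rule_format, of j f] assms(2,3) by (auto simp: slope_def)

text \<open>The value of \<open>M f\<close> at \<open>\<gamma> (Suc j)\<close> occurs both in the
  backward slope of \<open>f\<close> at \<open>Suc j\<close> and in the forward slope of
  \<open>M f\<close> at \<open>j\<close>. Eliminating it leaves twice the value of
  \<open>M (M f) - f\<close> at \<open>\<gamma> j\<close>, also at the end
  \<open>j = 0\<close>.\<close>

lemma slope_Suc:
  assumes "averages_along M \<gamma> L" "j < L"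
  shows "slope M \<gamma> L f (Suc j) = slope M \<gamma> L (M f) j + 2 * (M (M f) (\<gamma> j) - f (\<gamma> j))"
  using assms by (simp add: slope_backward) (simp add: slope_def)

lemma slope_pred:
  assumes "averages_along M \<gamma> L" "j < L"
  shows "slope M \<gamma> L f j = slope M \<gamma> L (M f) (Suc j) - 2 * (M (M f) (\<gamma> (Suc j)) - f (\<gamma> (Suc j)))"
  using assms by (simp add: slope_backward[of M \<gamma> L "Suc j"]) (simp add: slope_def)

text \<open>The corrections at \<open>\<gamma> j\<close> in \<open>slope_Suc\<close> and
  \<open>slope_pred\<close> are opposite and cancel. Thus taking slopes commutes with averaging
  inside a path.\<close>

lemma slope_mean:
  assumes "averages_along M \<gamma> L" "0 < j" "j < L"
  shows "slope M \<gamma> L f (j - 1) + slope M \<gamma> L f (Suc j) = 2 * slope M \<gamma> L (M f) j"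
  using slope_Suc[OF assms(1,3), of f] slope_pred[OF assms(1), of "j - 1" f] assms(2,3)
  by simp

subsection \<open>The Markov operator of a gear\<close>

locale gear_data =
  fixes n :: nat and l :: "nat \<Rightarrow> nat" and w :: real
  assumes n: "n \<ge> 3" and l: "\<And>i. i < n \<Longrightarrow> l i > 0" and w: "w > 0"
begin

abbreviation nxt :: "nat \<Rightarrow> nat" where "nxt i \<equiv> Suc i mod n"

definition side :: "nat \<Rightarrow> nat \<Rightarrow> gear_point" where
  "side i k = (if k = 0 then Vertex (Corner i) else if k = l i then Vertex (Corner (nxt i)) else Inner (Side i) k)"

text \<open>
  The position \<open>j\<close> on a tooth is that of the parallel side point, so the tooth is glued to its side
  at \<open>l i\<close> if \<open>a i\<close> and at \<open>0\<close> otherwise.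
\<close>

definition tooth :: "(nat \<Rightarrow> bool) \<Rightarrow> nat \<Rightarrow> nat \<Rightarrow> gear_point" where
  "tooth a i j =
    (if a i then (if j = l i then Vertex (Corner (nxt i)) else if j = 0 then Vertex (Leaf i) else Inner (Tooth i) (l i - j))
     else (if j = 0 then Vertex (Corner i) else if j = l i then Vertex (Leaf i) else Inner (Tooth i) j))"

abbreviation markov :: "(nat \<Rightarrow> bool) \<Rightarrow> (gear_point \<Rightarrow> real) \<Rightarrow> gear_point \<Rightarrow> real" where
  "markov a \<equiv> markov_op (gear n l a) w"

section \<open>Cyclic successor and strand coordinates\<close>

lemma nxt_less [simp]: "nxt i < n"
  using n by simp

text \<open>Since neighbours form sets, coinciding neighbours would be counted once. The second
  inequality keeps the two polygon neighbours of a corner distinct when both adjacent sides have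
  length 1; the first does so for the midpoint of a side of length 2.\<close>

lemma nxt_neq: "i < n \<Longrightarrow> nxt i \<noteq> i" "i < n \<Longrightarrow> nxt (nxt i) \<noteq> i"
  using n by (auto simp: mod_Suc split: if_splits)

lemma nxt_inj: "i < n \<Longrightarrow> j < n \<Longrightarrow> nxt i = nxt j \<longleftrightarrow> i = j"
  using n by (auto simp: mod_Suc split: if_splits)

lemma nxt_surj:
  assumes "c < n"
  obtains i where "i < n" "nxt i = c"
proof (cases c)
  case 0
  then show ?thesis using that[of "n - 1"] n by simp
next
  case (Suc i)
  then show ?thesis using that[of i] assms by simp
qed

lemma side_eq_iff:
  "side i k = Vertex (Corner c) \<longleftrightarrow> k = 0 \<and> c = i \<or> k \<noteq> 0 \<and> k = l i \<and> c = nxt i"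
  "side i k \<noteq> Vertex (Leaf c)"
  "side i k = Inner e j \<longleftrightarrow> k \<noteq> 0 \<and> k \<noteq> l i \<and> e = Side i \<and> j = k"
  by (auto simp: side_def)

lemma tooth_eq_iff:
  assumes "i < n" "k \<le> l i"
  shows "tooth a i k = Vertex (Corner c) \<longleftrightarrow> (if a i then k = l i \<and> c = nxt i else k = 0 \<and> c = i)"
    and "tooth a i k = Vertex (Leaf c) \<longleftrightarrow> c = i \<and> k = (if a i then 0 else l i)"
    and "tooth a i k = Inner e j \<longleftrightarrow> k \<noteq> 0 \<and> k \<noteq> l i \<and> e = Tooth i \<and> j = (if a i then l i - k else k)"
  using assms l[of i] by (auto simp: tooth_def)

section \<open>Unit edges and neighbours in strand coordinates\<close>

lemma unit_edges_side:
  assumes "i < n"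
  shows "unit_edges (gear n l a) (Side i) = {{side i k, side i (Suc k)} | k. k < l i}"
proof -
  have "point_at (gear n l a) (Side i) k = side i k" for k
    by (simp add: point_at_def gear_def side_def)
  then show ?thesis by (simp add: unit_edges_def gear_def)
qed

text \<open>\<open>point_at\<close> counts from the attached corner, while \<open>tooth\<close>
  counts parallel to the side. If \<open>a i\<close> holds, the two directions are opposite and the
  unit edge \<open>k\<close> becomes the unit edge \<open>l i - Suc k\<close>.\<close>

lemma unit_edges_tooth:
  assumes "i < n"
  shows "unit_edges (gear n l a) (Tooth i) = {{tooth a i k, tooth a i (Suc k)} | k. k < l i}"
proof (cases "a i")
  case False
  then have "point_at (gear n l a) (Tooth i) k = tooth a i k" for k
    by (simp add: point_at_def gear_def tooth_def)
  then show ?thesis by (simp add: unit_edges_def gear_def)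
next
  case True
  have pt: "point_at (gear n l a) (Tooth i) k = tooth a i (l i - k)" if "k \<le> l i" for k
    using True that l[OF assms] by (auto simp: point_at_def gear_def tooth_def)
  have len: "len (gear n l a) (Tooth i) = l i"
    by (simp add: gear_def)
  show ?thesis
  proof (intro equalityI subsetI)
    fix e assume "e \<in> unit_edges (gear n l a) (Tooth i)"
    then obtain k where k: "k < l i" "e = {tooth a i (l i - k), tooth a i (l i - Suc k)}"
      by (auto simp: unit_edges_def len pt)
    then have "e = {tooth a i (l i - Suc k), tooth a i (Suc (l i - Suc k))}"
      by (simp add: Suc_diff_Suc insert_commute)
    then show "e \<in> {{tooth a i k, tooth a i (Suc k)} | k. k < l i}"
      using k(1) by fastforce
  next
    fix e assume "e \<in> {{tooth a i k, tooth a i (Suc k)} | k. k < l i}"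
    then obtain k where k: "k < l i" "e = {tooth a i k, tooth a i (Suc k)}"
      by auto
    then have "e = {point_at (gear n l a) (Tooth i) (l i - Suc k), point_at (gear n l a) (Tooth i) (Suc (l i - Suc k))}"
      by (simp add: Suc_diff_Suc insert_commute pt)
    then show "e \<in> unit_edges (gear n l a) (Tooth i)"
      unfolding unit_edges_def len using k(1) by force
  qed
qed

text \<open>A common description for the families \<open>side\<close> and \<open>tooth a\<close>, so
  that polygon and tooth neighbours are computed in the same way.\<close>

definition strand_nbrs :: "(nat \<Rightarrow> nat \<Rightarrow> gear_point) \<Rightarrow> gear_point \<Rightarrow> gear_point set" where
  "strand_nbrs \<gamma> v =
    {v'. \<exists>i<n. \<exists>k<l i. v = \<gamma> i k \<and> v' = \<gamma> i (Suc k) \<or> v = \<gamma> i (Suc k) \<and> v' = \<gamma> i k}"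

lemma strand_nbrsI:
  "i < n \<Longrightarrow> k < l i \<Longrightarrow> \<gamma> i (Suc k) \<in> strand_nbrs \<gamma> (\<gamma> i k)"
  "i < n \<Longrightarrow> k < l i \<Longrightarrow> \<gamma> i k \<in> strand_nbrs \<gamma> (\<gamma> i (Suc k))"
  by (auto simp: strand_nbrs_def)

lemma strand_nbrsE:
  assumes "v' \<in> strand_nbrs \<gamma> v"
  obtains i k where "i < n" "k < l i" "v = \<gamma> i k" "v' = \<gamma> i (Suc k)"
    | i k where "i < n" "k < l i" "v = \<gamma> i (Suc k)" "v' = \<gamma> i k"
  using assms by (auto simp: strand_nbrs_def)

lemma arcs_gear: "arcs (gear n l a) = Side ` {..<n} \<union> Tooth ` {..<n}"
  by (simp add: gear_def)

lemma polygon_nbrs_gear: "polygon_nbrs (gear n l a) v = strand_nbrs side v"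
proof (rule Set.set_eqI)
  fix v'
  have "v' \<in> polygon_nbrs (gear n l a) v \<longleftrightarrow> (\<exists>i<n. {v, v'} \<in> unit_edges (gear n l a) (Side i))"
    by (auto simp: polygon_nbrs_def arcs_gear bex_Un)
  also have "\<dots> \<longleftrightarrow> (\<exists>i<n. \<exists>k<l i. {v, v'} = {side i k, side i (Suc k)})"
    by (intro ex_cong1 conj_cong refl) (simp add: unit_edges_side, blast)
  finally show "v' \<in> polygon_nbrs (gear n l a) v \<longleftrightarrow> v' \<in> strand_nbrs side v"
    by (simp add: strand_nbrs_def doubleton_eq_iff)
qed

lemma tooth_nbrs_gear: "tooth_nbrs (gear n l a) v = strand_nbrs (tooth a) v"
proof (rule Set.set_eqI)
  fix v'
  have "v' \<in> tooth_nbrs (gear n l a) v \<longleftrightarrow> (\<exists>i<n. {v, v'} \<in> unit_edges (gear n l a) (Tooth i))"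
    by (auto simp: tooth_nbrs_def arcs_gear bex_Un)
  also have "\<dots> \<longleftrightarrow> (\<exists>i<n. \<exists>k<l i. {v, v'} = {tooth a i k, tooth a i (Suc k)})"
    by (intro ex_cong1 conj_cong refl) (simp add: unit_edges_tooth, blast)
  finally show "v' \<in> tooth_nbrs (gear n l a) v \<longleftrightarrow> v' \<in> strand_nbrs (tooth a) v"
    by (simp add: strand_nbrs_def doubleton_eq_iff)
qed

section \<open>The Markov operator at interior points, leaves and corners\<close>

lemma strand_nbrs_interior:
  assumes "i < n" "Suc m < l i"
    and inj: "\<And>i' k. i' < n \<Longrightarrow> k \<le> l i' \<Longrightarrow> \<gamma> i (Suc m) = \<gamma> i' k \<Longrightarrow> i' = i \<and> k = Suc m"
  shows "strand_nbrs \<gamma> (\<gamma> i (Suc m)) = {\<gamma> i m, \<gamma> i (Suc (Suc m))}"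
proof (intro equalityI subsetI)
  fix v' assume "v' \<in> strand_nbrs \<gamma> (\<gamma> i (Suc m))"
  then show "v' \<in> {\<gamma> i m, \<gamma> i (Suc (Suc m))}"
  proof (cases rule: strand_nbrsE)
    case (1 i' k)
    then show ?thesis using inj[of i' k] by auto
  next
    case (2 i' k)
    then show ?thesis using inj[of i' "Suc k"] by auto
  qed
qed (use assms(1,2) strand_nbrsI[of i m \<gamma>] strand_nbrsI[of i "Suc m" \<gamma>] in auto)

lemma averages_along_side:
  assumes "i < n"
  shows "averages_along (markov a) (side i) (l i)"
  unfolding averages_along_def
proof (intro allI impI)
  fix f j assume "0 < j \<and> j < l i"
  then obtain m where m: "j = Suc m" "Suc m < l i" by (cases j) auto
  have v: "side i (Suc m) = Inner (Side i) (Suc m)" using m by (simp add: side_def)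
  have P: "polygon_nbrs (gear n l a) (side i (Suc m)) = {side i m, side i (Suc (Suc m))}"
    unfolding polygon_nbrs_gear using assms m(2)
    by (rule strand_nbrs_interior) (auto simp: v side_eq_iff dest!: sym[of "Inner _ _"])
  have T: "tooth_nbrs (gear n l a) (side i (Suc m)) = {}"
    unfolding tooth_nbrs_gear v
    by (auto elim!: strand_nbrsE simp: tooth_eq_iff dest!: sym[of "Inner _ _"])
  have ne: "side i m \<noteq> side i (Suc (Suc m))"
    using m nxt_neq(1)[OF assms] by (auto simp: side_def)
  show "2 * markov a f (side i j) = f (side i (j - 1)) + f (side i (Suc j))"
    using ne by (simp add: markov_op_def P T m(1))
qed

lemma averages_along_tooth:
  assumes "i < n"
  shows "averages_along (markov a) (tooth a i) (l i)"
  unfolding averages_along_def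
proof (intro allI impI)
  fix f j assume "0 < j \<and> j < l i"
  then obtain m where m: "j = Suc m" "Suc m < l i" by (cases j) auto
  have v: "tooth a i (Suc m) = Inner (Tooth i) (if a i then l i - Suc m else Suc m)"
    using m by (simp add: tooth_def)
  have P: "polygon_nbrs (gear n l a) (tooth a i (Suc m)) = {}"
    unfolding polygon_nbrs_gear v
    by (auto elim!: strand_nbrsE simp: side_eq_iff dest!: sym[of "Inner _ _"])
  have T: "tooth_nbrs (gear n l a) (tooth a i (Suc m)) = {tooth a i m, tooth a i (Suc (Suc m))}"
    unfolding tooth_nbrs_gear using assms m(2)
  proof (rule strand_nbrs_interior)
    fix i' k assume ik: "i' < n" "k \<le> l i'" "tooth a i (Suc m) = tooth a i' k"
    show "i' = i \<and> k = Suc m"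
      using tooth_eq_iff(3)[OF ik(1,2), THEN iffD1, OF ik(3)[symmetric, unfolded v]] ik(2) m(2)
      by (cases "a i") auto
  qed
  have ne: "tooth a i m \<noteq> tooth a i (Suc (Suc m))"
    using m by (auto simp: tooth_def)
  show "2 * markov a f (tooth a i j) = f (tooth a i (j - 1)) + f (tooth a i (Suc j))"
    using ne w by (simp add: markov_op_def P T m(1) field_simps)
qed

lemma markov_leaf:
  assumes "i < n"
  shows "markov a f (Vertex (Leaf i)) = f (tooth a i (if a i then 1 else l i - 1))"
proof -
  obtain L where L: "l i = Suc L" using l[OF assms] by (cases "l i") auto
  have P: "polygon_nbrs (gear n l a) (Vertex (Leaf i)) = {}"
    unfolding polygon_nbrs_gear
    by (auto elim!: strand_nbrsE simp: side_eq_iff dest!: sym[of "Vertex _"])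
  have T: "tooth_nbrs (gear n l a) (Vertex (Leaf i)) = {tooth a i (if a i then 1 else L)}"
    unfolding tooth_nbrs_gear
  proof (intro equalityI subsetI)
    fix v' assume "v' \<in> strand_nbrs (tooth a) (Vertex (Leaf i))"
    then show "v' \<in> {tooth a i (if a i then 1 else L)}"
      by (cases rule: strand_nbrsE)
        (auto simp: tooth_eq_iff L dest!: sym[of "Vertex _"] split: if_splits)
  next
    fix v' assume "v' \<in> {tooth a i (if a i then 1 else L)}"
    then show "v' \<in> strand_nbrs (tooth a) (Vertex (Leaf i))"
      using strand_nbrsI(1)[OF assms, of 0 "tooth a"] strand_nbrsI(2)[OF assms, of L "tooth a"] L
      by (auto simp: tooth_def split: if_splits)
  qed
  show ?thesis
    using w by (simp add: markov_op_def P T L)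
qed

text \<open>Besides the sides \<open>i\<close> and \<open>nxt i\<close>, only the far end of tooth
  \<open>i\<close> and the near end of tooth \<open>nxt i\<close> can sit at this corner; the
  \<open>of_bool\<close> factors record which of them do. Writing the corner as \<open>nxt i\<close>
  avoids a cyclic predecessor.\<close>

lemma markov_corner:
  assumes "i < n"
  shows "(2 + w * (of_bool (\<not> a (nxt i)) + of_bool (a i))) * markov a f (Vertex (Corner (nxt i))) =
    f (side (nxt i) 1) + f (side i (l i - 1)) +
    w * (of_bool (\<not> a (nxt i)) * f (tooth a (nxt i) 1) + of_bool (a i) * f (tooth a i (l i - 1)))"
proof -
  let ?c = "nxt i"
  obtain L where L: "l i = Suc L" using l[OF assms] by (cases "l i") auto
  have c: "0 < l ?c" using l by simp
  have corner: "side ?c 0 = Vertex (Corner ?c)" "side i (Suc L) = Vertex (Corner ?c)"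
    by (auto simp: side_def L)
  have corner': "\<not> a ?c \<Longrightarrow> tooth a ?c 0 = Vertex (Corner ?c)"
    "a i \<Longrightarrow> tooth a i (Suc L) = Vertex (Corner ?c)"
    by (auto simp: tooth_def L)
  have P: "polygon_nbrs (gear n l a) (Vertex (Corner ?c)) = {side ?c 1, side i L}"
    unfolding polygon_nbrs_gear
  proof (intro equalityI subsetI)
    fix v' assume "v' \<in> strand_nbrs side (Vertex (Corner ?c))"
    then show "v' \<in> {side ?c 1, side i L}"
      by (cases rule: strand_nbrsE)
        (use assms in \<open>auto simp: side_eq_iff nxt_inj L dest!: sym[of "Vertex _"]\<close>)
  next
    fix v' assume "v' \<in> {side ?c 1, side i L}"
    then show "v' \<in> strand_nbrs side (Vertex (Corner ?c))"
      using strand_nbrsI(1)[OF nxt_less c, of side] strand_nbrsI(2)[OF assms, of L side] L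
      by (auto simp: corner)
  qed
  have ne: "side ?c 1 \<noteq> side i L"
    using nxt_neq[OF assms] nxt_neq(1)[OF nxt_less[of i]] c L by (auto simp: side_def)
  have T: "tooth_nbrs (gear n l a) (Vertex (Corner ?c)) =
      (if a ?c then {} else {tooth a ?c 1}) \<union> (if a i then {tooth a i L} else {})"
    unfolding tooth_nbrs_gear
  proof (intro equalityI subsetI)
    fix v' assume "v' \<in> strand_nbrs (tooth a) (Vertex (Corner ?c))"
    then show "v' \<in> (if a ?c then {} else {tooth a ?c 1}) \<union> (if a i then {tooth a i L} else {})"
      by (cases rule: strand_nbrsE)
        (use assms in \<open>auto simp: tooth_eq_iff nxt_inj L dest!: sym[of "Vertex _"] split: if_splits\<close>)
  next
    fix v' assume "v' \<in> (if a ?c then {} else {tooth a ?c 1}) \<union> (if a i then {tooth a i L} else {})"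
    then show "v' \<in> strand_nbrs (tooth a) (Vertex (Corner ?c))"
      using strand_nbrsI(1)[OF nxt_less c, of "tooth a"] strand_nbrsI(2)[OF assms, of L "tooth a"] L corner'
      by (auto split: if_splits)
  qed
  have ne': "tooth a ?c 1 \<noteq> tooth a i L" if "\<not> a ?c" "a i"
    using nxt_neq[OF assms] c L that by (auto simp: tooth_def)
  have nz: "2 + w * 2 \<noteq> 0" "2 + w \<noteq> 0" using w by auto
  show ?thesis
    using ne ne' nz by (cases "a ?c"; cases "a i") (simp_all add: markov_op_def P T L distrib_left add.commute)
qed

subsection \<open>Transplantation to the dual gear\<close>

abbreviation dual :: "(nat \<Rightarrow> bool) \<Rightarrow> nat \<Rightarrow> bool" where "dual a \<equiv> \<lambda>i. \<not> a i"

definition side_slope :: "(nat \<Rightarrow> bool) \<Rightarrow> nat \<Rightarrow> (gear_point \<Rightarrow> real) \<Rightarrow> nat \<Rightarrow> real" where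
  "side_slope a i = slope (markov a) (side i) (l i)"

definition tooth_slope :: "(nat \<Rightarrow> bool) \<Rightarrow> nat \<Rightarrow> (gear_point \<Rightarrow> real) \<Rightarrow> nat \<Rightarrow> real" where
  "tooth_slope a i = slope (markov a) (tooth a i) (l i)"

text \<open>
  On vertices of the dual gear. The tooth \<open>i\<close> of the dual has its leaf at position \<open>l i\<close> if \<open>a i\<close>
  and at position \<open>0\<close> otherwise; \<open>transplant_side\<close> and \<open>transplant_tooth\<close> are the uniform description.
\<close>

fun transplant :: "(nat \<Rightarrow> bool) \<Rightarrow> (gear_point \<Rightarrow> real) \<Rightarrow> gear_point \<Rightarrow> real" where
  "transplant a f (Vertex (Corner i)) = side_slope a i f 0 + w * tooth_slope a i f 0"
| "transplant a f (Vertex (Leaf i)) =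
    (let j = if a i then l i else 0 in side_slope a i f j - tooth_slope a i f j)"
| "transplant a f (Inner (Side i) j) = side_slope a i f j + w * tooth_slope a i f j"
| "transplant a f (Inner (Tooth i) k) =
    (let j = if a i then k else l i - k in side_slope a i f j - tooth_slope a i f j)"

section \<open>Slopes at leaves and corners, and consistency of the transplant\<close>

lemmas side_slope_Suc = slope_Suc[OF averages_along_side, folded side_slope_def]
lemmas side_slope_pred = slope_pred[OF averages_along_side, folded side_slope_def]
lemmas side_slope_mean = slope_mean[OF averages_along_side, folded side_slope_def]
lemmas tooth_slope_Suc = slope_Suc[OF averages_along_tooth, folded tooth_slope_def]
lemmas tooth_slope_pred = slope_pred[OF averages_along_tooth, folded tooth_slope_def]
lemmas tooth_slope_mean = slope_mean[OF averages_along_tooth, folded tooth_slope_def]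

text \<open>At a leaf \<open>M f\<close> equals the single neighbouring value, so the slope
  vanishes: a discrete Neumann condition.\<close>

lemma tooth_slope_leaf:
  assumes "i < n"
  shows "tooth_slope a i f (if a i then 0 else l i) = 0"
  using l[OF assms] markov_leaf[OF assms, of a f]
  by (auto simp: tooth_slope_def slope_def tooth_def[of a i 0] tooth_def[of a i "l i"])

lemma side_0: "side i 0 = Vertex (Corner i)"
  by (simp add: side_def)

lemma side_len: "i < n \<Longrightarrow> side i (l i) = Vertex (Corner (nxt i))"
  using l[of i] by (simp add: side_def)

lemma tooth_0: "i < n \<Longrightarrow> tooth a i 0 = Vertex (if a i then Leaf i else Corner i)"
  using l[of i] by (simp add: tooth_def)

lemma tooth_len: "i < n \<Longrightarrow> tooth a i (l i) = Vertex (if a i then Corner (nxt i) else Leaf i)"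
  using l[of i] by (simp add: tooth_def)

text \<open>Kirchhoff's law, a reformulation of \<open>markov_corner\<close>.\<close>

lemma slope_balance:
  assumes "i < n"
  shows "side_slope a (nxt i) f 0 + w * tooth_slope a (nxt i) f 0 =
    side_slope a i f (l i) + w * tooth_slope a i f (l i)"
proof -
  let ?c = "nxt i"
  note l' = l[OF assms] l[OF nxt_less[of i]]
  have S: "side_slope a ?c f 0 = 2 * (f (side ?c 1) - markov a f (Vertex (Corner ?c)))"
    "side_slope a i f (l i) = 2 * (markov a f (Vertex (Corner ?c)) - f (side i (l i - 1)))"
    using l' assms by (simp_all add: side_slope_def slope_def side_0 side_len)
  \<comment> \<open>A tooth whose leaf lies at this position has slope 0, so only teeth glued to the
    corner contribute.\<close>
  have T: "tooth_slope a ?c f 0 =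
      (if a ?c then 0 else 2 * (f (tooth a ?c 1) - markov a f (Vertex (Corner ?c))))"
    "tooth_slope a i f (l i) =
      (if a i then 2 * (markov a f (Vertex (Corner ?c)) - f (tooth a i (l i - 1))) else 0)"
    using l' assms tooth_slope_leaf[OF assms, of a f] tooth_slope_leaf[OF nxt_less[of i], of a f]
    by (auto simp: tooth_slope_def slope_def tooth_0 tooth_len)
  show ?thesis
    using markov_corner[OF assms, of a f] unfolding S T
    by (cases "a ?c"; cases "a i") (simp_all add: algebra_simps)
qed

text \<open>The far corner takes its value from the next side, so the case \<open>j = l i\<close> is
  exactly the balance of slopes.\<close>

lemma transplant_side:
  assumes "i < n" "j \<le> l i"
  shows "transplant a f (side i j) = side_slope a i f j + w * tooth_slope a i f j"
  using assms slope_balance[OF assms(1), of a f] l[OF assms(1)] by (auto simp: side_def)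

text \<open>The dual tooth is glued where the original tooth has its leaf. The tooth slope vanishes
  there, so the corner value agrees with the tooth formula despite the different
  coefficient.\<close>

lemma transplant_tooth:
  assumes "i < n" "j \<le> l i"
  shows "transplant a f (tooth (dual a) i j) = side_slope a i f j - tooth_slope a i f j"
  using assms slope_balance[OF assms(1), of a f] l[OF assms(1)] tooth_slope_leaf[OF assms(1), of a f]
  by (auto simp: tooth_def Let_def)

section \<open>Pointwise intertwining of the two Markov operators\<close>

lemma transplant_interior:
  assumes "i < n" "0 < j" "j < l i"
  shows "markov (dual a) (transplant a f) (side i j) = transplant a (markov a f) (side i j)"
    and "markov (dual a) (transplant a f) (tooth (dual a) i j) = transplant a (markov a f) (tooth (dual a) i j)"
proof -
  have s: "side_slope a i f (Suc j) = 2 * side_slope a i (markov a f) j - side_slope a i f (j - 1)"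
    and t: "tooth_slope a i f (Suc j) = 2 * tooth_slope a i (markov a f) j - tooth_slope a i f (j - 1)"
    using side_slope_mean[OF assms, of a f] tooth_slope_mean[OF assms, of a f] by simp_all
  show "markov (dual a) (transplant a f) (side i j) = transplant a (markov a f) (side i j)"
    "markov (dual a) (transplant a f) (tooth (dual a) i j) = transplant a (markov a f) (tooth (dual a) i j)"
    using averages_along_side[OF assms(1), of "dual a", unfolded averages_along_def, rule_format, of j "transplant a f"]
      averages_along_tooth[OF assms(1), of "dual a", unfolded averages_along_def, rule_format, of j "transplant a f"]
      assms
    by (simp_all add: transplant_side transplant_tooth s t algebra_simps)
qed

lemma transplant_leaf:
  assumes "i < n"
  shows "markov (dual a) (transplant a f) (Vertex (Leaf i)) = transplant a (markov a f) (Vertex (Leaf i))"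
proof (cases "a i")
  case False
  have "markov (dual a) (transplant a f) (Vertex (Leaf i)) = transplant a f (tooth (dual a) i (Suc 0))"
    using False markov_leaf[OF assms, of "dual a"] by simp
  also have "\<dots> = side_slope a i f (Suc 0) - tooth_slope a i f (Suc 0)"
    using l[OF assms] by (intro transplant_tooth[OF assms]) simp
  also have "\<dots> = side_slope a i (markov a f) 0 - tooth_slope a i (markov a f) 0"
    using side_slope_Suc[OF assms l[OF assms], of a f] tooth_slope_Suc[OF assms l[OF assms], of a f]
      False assms by (simp add: side_0 tooth_0)
  finally show ?thesis using False by (simp add: Let_def)
next
  case True
  obtain L where L: "l i = Suc L" using l[OF assms] by (cases "l i") auto
  have "markov (dual a) (transplant a f) (Vertex (Leaf i)) = transplant a f (tooth (dual a) i L)"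
    using True markov_leaf[OF assms, of "dual a"] L by simp
  also have "\<dots> = side_slope a i f L - tooth_slope a i f L"
    using L by (intro transplant_tooth[OF assms]) simp
  also have "\<dots> = side_slope a i (markov a f) (l i) - tooth_slope a i (markov a f) (l i)"
    using side_slope_pred[OF assms, of L a f] tooth_slope_pred[OF assms, of L a f]
      side_len[OF assms] tooth_len[OF assms, of a] True L by simp
  finally show ?thesis using True by (simp add: Let_def)
qed

text \<open>Compared with the slopes of \<open>M f\<close> at the corner, slopes one step forward
  gain \<open>2 * E\<close> and slopes one step back lose it. Each direction has total weight
  \<open>1 + w\<close>, so the corrections cancel.\<close>

lemma transplant_corner:
  assumes "i < n"
  shows "markov (dual a) (transplant a f) (Vertex (Corner (nxt i))) =
    transplant a (markov a f) (Vertex (Corner (nxt i)))"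
proof -
  let ?c = "nxt i" and ?Mf = "markov a f"
  let ?X = "transplant a ?Mf (Vertex (Corner ?c))"
  define E where "E = markov a ?Mf (Vertex (Corner ?c)) - f (Vertex (Corner ?c))"
  let ?h = "transplant a f"
  obtain L where L: "l i = Suc L" using l[OF assms] by (cases "l i") auto
  have c: "?c < n" "0 < l ?c" using l by auto
  have X: "?X = side_slope a ?c ?Mf 0 + w * tooth_slope a ?c ?Mf 0"
    "?X = side_slope a i ?Mf (l i) + w * tooth_slope a i ?Mf (l i)"
    using slope_balance[OF assms, of a ?Mf] by auto
  have s: "side_slope a ?c f 1 = side_slope a ?c ?Mf 0 + 2 * E"
    using side_slope_Suc[OF c, of a f] by (simp add: side_0 E_def)
  have s': "side_slope a i f L = side_slope a i ?Mf (l i) - 2 * E"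
    using side_slope_pred[OF assms, of L a f] side_len[OF assms] L by (simp add: E_def)
  have t: "tooth_slope a ?c f 1 = tooth_slope a ?c ?Mf 0 + 2 * E" if "\<not> a ?c"
    using tooth_slope_Suc[OF c, of a f] that c by (simp add: tooth_0 E_def)
  have t': "tooth_slope a i f L = tooth_slope a i ?Mf (l i) - 2 * E" if "a i"
    using tooth_slope_pred[OF assms, of L a f] tooth_len[OF assms, of a] L that by (simp add: E_def)
  \<comment> \<open>If \<open>a ?c\<close> holds, the dual tooth starts here: the weighted sum
    cancels the tooth slopes and leaves \<open>1 + w\<close> times the side slope. Otherwise only
    the side contributes, and its side and tooth slopes both shift by \<open>2 * E\<close>.\<close>
  have "?h (side ?c 1) + w * (of_bool (a ?c) * ?h (tooth (dual a) ?c 1)) =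
      (1 + w * of_bool (a ?c)) * ?X + 2 * (1 + w) * E"
    unfolding X(1) using c s t tooth_slope_leaf[OF c(1), of a ?Mf]
    by (cases "a ?c") (simp_all add: transplant_side transplant_tooth algebra_simps)
  moreover have "?h (side i L) + w * (of_bool (\<not> a i) * ?h (tooth (dual a) i L)) =
      (1 + w * of_bool (\<not> a i)) * ?X - 2 * (1 + w) * E"
    unfolding X(2) using L assms tooth_slope_leaf[OF assms, of a ?Mf]
    by (cases "a i") (simp_all add: transplant_side transplant_tooth s' t' algebra_simps)
  moreover have "(2 + w * (of_bool (a ?c) + of_bool (\<not> a i))) * markov (dual a) ?h (Vertex (Corner ?c)) =
      (?h (side ?c 1) + w * (of_bool (a ?c) * ?h (tooth (dual a) ?c 1))) +
      (?h (side i L) + w * (of_bool (\<not> a i) * ?h (tooth (dual a) i L)))"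
    using markov_corner[OF assms, of "dual a" ?h] L by (simp add: algebra_simps)
  ultimately have "(2 + w * (of_bool (a ?c) + of_bool (\<not> a i))) * markov (dual a) ?h (Vertex (Corner ?c)) =
      (2 + w * (of_bool (a ?c) + of_bool (\<not> a i))) * ?X"
    by (simp only:) (simp add: algebra_simps)
  moreover have "2 + w * (of_bool (a ?c) + of_bool (\<not> a i)) \<noteq> 0"
    using w by auto
  ultimately show ?thesis by simp
qed

section \<open>Strand points, the intertwining identity and the composite of the
  transplantations\<close>

lemma gear_points:
  "subdiv_verts (gear n l a) = {v. \<exists>i<n. \<exists>j\<le>l i. v = side i j \<or> v = tooth a i j}"
proof (intro Set.set_eqI iffI)
  fix v assume "v \<in> subdiv_verts (gear n l a)"
  then consider c where "c < n" "v = Vertex (Corner c)" | c where "c < n" "v = Vertex (Leaf c)"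
    | i j where "i < n" "0 < j" "j < l i" "v = Inner (Side i) j"
    | i j where "i < n" "0 < j" "j < l i" "v = Inner (Tooth i) j"
    by (auto simp: subdiv_verts_def gear_def)
  then have "\<exists>i j. i < n \<and> j \<le> l i \<and> (v = side i j \<or> v = tooth a i j)"
  proof cases
    case 1
    then have "c < n \<and> 0 \<le> l c \<and> v = side c 0" by (simp add: side_0)
    then show ?thesis by blast
  next
    case 2
    then have "c < n \<and> (if a c then 0 else l c) \<le> l c \<and> v = tooth a c (if a c then 0 else l c)"
      by (simp add: tooth_0 tooth_len)
    then show ?thesis by blast
  next
    case 3
    then have "i < n \<and> j \<le> l i \<and> v = side i j" by (simp add: side_def)
    then show ?thesis by blast
  next
    case 4
    then have "i < n \<and> (if a i then l i - j else j) \<le> l i \<and> v = tooth a i (if a i then l i - j else j)"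
      by (auto simp: tooth_def)
    then show ?thesis by blast
  qed
  then show "v \<in> {v. \<exists>i<n. \<exists>j\<le>l i. v = side i j \<or> v = tooth a i j}"
    by blast
next
  fix v assume "v \<in> {v. \<exists>i<n. \<exists>j\<le>l i. v = side i j \<or> v = tooth a i j}"
  then show "v \<in> subdiv_verts (gear n l a)"
    using n by (auto simp: side_def tooth_def subdiv_verts_def gear_def)
qed

lemma subdiv_verts_dual: "subdiv_verts (gear n l (dual a)) = subdiv_verts (gear n l a)"
  by (simp add: subdiv_verts_def gear_def)

lemma gear_points_cases:
  assumes "v \<in> subdiv_verts (gear n l a)"
  obtains (corner) i where "i < n" "v = Vertex (Corner (nxt i))"
    | (leaf) i where "i < n" "v = Vertex (Leaf i)"
    | (side) i j where "i < n" "0 < j" "j < l i" "v = side i j"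
    | (tooth) i j where "i < n" "0 < j" "j < l i" "v = tooth a i j"
proof -
  from assms obtain i j where ij: "i < n" "j \<le> l i" "v = side i j \<or> v = tooth a i j"
    by (auto simp: gear_points)
  obtain p where p: "p < n" "nxt p = i" using nxt_surj[OF ij(1)] .
  show ?thesis
  proof (cases "0 < j \<and> j < l i")
    case True
    then show ?thesis using ij side tooth by blast
  next
    case False
    then have "v = Vertex (Corner i) \<or> v = Vertex (Corner (nxt i)) \<or> v = Vertex (Leaf i)"
      using ij by (auto simp: side_0 side_len tooth_0 tooth_len split: if_splits)
    then show ?thesis using corner[of p] corner[of i] leaf[of i] p ij(1) by metis
  qed
qed

lemma transplant_intertwines:
  assumes "v \<in> subdiv_verts (gear n l a)"
  shows "markov (dual a) (transplant a f) v = transplant a (markov a f) v"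
proof -
  have "v \<in> subdiv_verts (gear n l (dual a))"
    using assms by (simp add: subdiv_verts_dual)
  then show ?thesis
  proof (cases rule: gear_points_cases)
    case corner
    then show ?thesis using transplant_corner by simp
  next
    case leaf
    then show ?thesis using transplant_leaf by simp
  next
    case side
    then show ?thesis using transplant_interior(1) by simp
  next
    case tooth
    then show ?thesis using transplant_interior(2) by simp
  qed
qed

text \<open>Intertwining replaces the dual Markov operator on the transplant by the transplant of
  \<open>markov a f\<close>. Each difference of slopes is then \<open>2 * E\<close> by
  \<open>slope_Suc\<close>, and the outer slope supplies another factor 2.\<close>

lemma slope_transplant:
  fixes a :: "nat \<Rightarrow> bool" and f :: "gear_point \<Rightarrow> real"
  assumes "i < n" "j \<le> l i"
  defines "E v \<equiv> markov a (markov a f) v - f v"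
  shows "side_slope (dual a) i (transplant a f) j = 4 * (E (side i j) + w * E (tooth a i j))"
    and "tooth_slope (dual a) i (transplant a f) j = 4 * (E (side i j) - E (tooth a i j))"
proof -
  have V: "side i j \<in> subdiv_verts (gear n l a)" "tooth (dual a) i j \<in> subdiv_verts (gear n l a)"
    using assms(1,2) gear_points[of a] gear_points[of "dual a"] subdiv_verts_dual[of a] by auto
  note inter = transplant_intertwines[OF V(1)] transplant_intertwines[OF V(2)]
  show "side_slope (dual a) i (transplant a f) j = 4 * (E (side i j) + w * E (tooth a i j))"
    "tooth_slope (dual a) i (transplant a f) j = 4 * (E (side i j) - E (tooth a i j))"
  proof (atomize(full), cases "j < l i")
    case True
    then show "side_slope (dual a) i (transplant a f) j = 4 * (E (side i j) + w * E (tooth a i j)) \<and>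
        tooth_slope (dual a) i (transplant a f) j = 4 * (E (side i j) - E (tooth a i j))"
      using assms(1)
      unfolding side_slope_def[of "dual a"] tooth_slope_def[of "dual a"] slope_def inter
      by (simp add: transplant_side transplant_tooth E_def side_slope_Suc tooth_slope_Suc algebra_simps)
  next
    \<comment> \<open>At the far end the outer slope is the backward one, so
      \<open>slope_pred\<close> takes the place of \<open>slope_Suc\<close>.\<close>
    case False
    then obtain L where L: "j = Suc L" "l i = Suc L" "L < l i"
      using assms(2) l[OF assms(1)] by (cases "l i") auto
    then show "side_slope (dual a) i (transplant a f) j = 4 * (E (side i j) + w * E (tooth a i j)) \<and>
        tooth_slope (dual a) i (transplant a f) j = 4 * (E (side i j) - E (tooth a i j))"
      using False assms(1)
      unfolding side_slope_def[of "dual a"] tooth_slope_def[of "dual a"] slope_def inter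
      by (simp add: transplant_side transplant_tooth E_def algebra_simps
          side_slope_pred[OF assms(1) L(3), of a f] tooth_slope_pred[OF assms(1) L(3), of a f])
  qed
qed

text \<open>The coefficient matrix with rows \<open>(1, w)\<close> and \<open>(1, -1)\<close> has
  square \<open>1 + w\<close> times the identity, so side and tooth contributions separate.\<close>

lemma transplant_transplant:
  assumes "v \<in> subdiv_verts (gear n l a)"
  shows "transplant (dual a) (transplant a f) v = 4 * (1 + w) * (markov a (markov a f) v - f v)"
proof -
  from assms obtain i j where ij: "i < n" "j \<le> l i" and v: "v = side i j \<or> v = tooth a i j"
    by (auto simp: gear_points)
  have dual_tooth: "transplant (dual a) h (tooth a i j) = side_slope (dual a) i h j - tooth_slope (dual a) i h j" for h
    using transplant_tooth[OF ij, of "dual a"] by simp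
  then show ?thesis
    using v ij by (auto simp: transplant_side dual_tooth slope_transplant algebra_simps)
qed

section \<open>Finite support, vanishing trace and matrix identities\<close>

lemma strand_nbrs_subset:
  assumes "\<And>i j. i < n \<Longrightarrow> j \<le> l i \<Longrightarrow> \<gamma> i j \<in> V"
  shows "strand_nbrs \<gamma> v \<subseteq> V"
  using assms by (auto elim!: strand_nbrsE)

lemma finite_gear_points: "finite (subdiv_verts (gear n l a))"
proof -
  have "subdiv_verts (gear n l a) =
      (\<Union>i<n. side i ` {..l i}) \<union> (\<Union>i<n. tooth a i ` {..l i})"
    by (auto simp: gear_points)
  then show ?thesis by simp
qed

lemma supported_linear_markov:
  "supported_linear (subdiv_verts (gear n l a)) (\<lambda>f. markov a f v)"
proof -
  have "strand_nbrs side v \<subseteq> subdiv_verts (gear n l a)"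
    "strand_nbrs (tooth a) v \<subseteq> subdiv_verts (gear n l a)"
    by (rule strand_nbrs_subset; auto simp: gear_points)+
  then show ?thesis
    unfolding markov_op_def polygon_nbrs_gear tooth_nbrs_gear
    by (intro supported_linear_cmult supported_linear_add supported_linear_sum supported_linear_eval
        finite_gear_points) auto
qed

lemma supported_linear_slope:
  assumes "\<And>j. j \<le> L \<Longrightarrow> \<gamma> j \<in> subdiv_verts (gear n l a)" "j \<le> L"
  shows "supported_linear (subdiv_verts (gear n l a)) (\<lambda>f. slope (markov a) \<gamma> L f j)"
  unfolding slope_def using assms
  by (cases "j < L")
    (auto intro!: supported_linear_cmult supported_linear_diff supported_linear_markov
      supported_linear_eval finite_gear_points)

lemma supported_linear_transplant:
  assumes "v \<in> subdiv_verts (gear n l a)"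
  shows "supported_linear (subdiv_verts (gear n l a)) (\<lambda>f. transplant a f v)"
proof -
  have "v \<in> subdiv_verts (gear n l (dual a))"
    using assms by (simp add: subdiv_verts_dual)
  then obtain i j where ij: "i < n" "j \<le> l i" and v: "v = side i j \<or> v = tooth (dual a) i j"
    by (auto simp: gear_points)
  have S: "supported_linear (subdiv_verts (gear n l a)) (\<lambda>f. side_slope a i f j)"
    "supported_linear (subdiv_verts (gear n l a)) (\<lambda>f. tooth_slope a i f j)"
    unfolding side_slope_def tooth_slope_def
    by (rule supported_linear_slope; use ij in \<open>auto simp: gear_points\<close>)+
  from v have "(\<lambda>f. transplant a f v) = (\<lambda>f. side_slope a i f j + w * tooth_slope a i f j) \<or>
      (\<lambda>f. transplant a f v) = (\<lambda>f. side_slope a i f j - tooth_slope a i f j)"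
    using ij by (auto simp: transplant_side transplant_tooth)
  then show ?thesis
    using supported_linear_add[OF S(1) supported_linear_cmult[OF S(2), of w]] supported_linear_diff[OF S]
    by auto
qed

text \<open>The subdivision has no loops, so the diagonal of the Markov matrix is zero. This
  supplies the first power trace for the induction.\<close>

lemma markov_indicator_self: "markov a (indicator {v}) v = 0"
proof -
  have "side i k \<noteq> side i (Suc k)" if "i < n" "k < l i" for i k
    using that nxt_neq(1)[of i] by (auto simp: side_def)
  moreover have "tooth a i k \<noteq> tooth a i (Suc k)" if "i < n" "k < l i" for i k
    using that by (auto simp: tooth_def)
  ultimately have "v \<notin> polygon_nbrs (gear n l a) v" "v \<notin> tooth_nbrs (gear n l a) v"
    unfolding polygon_nbrs_gear tooth_nbrs_gear by (auto elim!: strand_nbrsE) metis+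
  then have "(\<Sum>u\<in>polygon_nbrs (gear n l a) v. indicator {v} u :: real) = 0"
    "(\<Sum>u\<in>tooth_nbrs (gear n l a) v. w * indicator {v} u :: real) = 0"
    by (auto intro!: sum.neutral simp: indicator_def)
  then show ?thesis by (simp add: markov_op_def)
qed

lemma mat_trace_markov: "mat_trace (op_mat (markov a) vs vs) = 0"
  by (simp add: mat_trace_def op_mat_def markov_indicator_self)

lemma markov_op_mat: "markov_matrix (gear n l a) w vs = op_mat (markov a) vs vs"
  by (simp add: markov_matrix_def op_mat_def)

lemma op_mat_transplant_transplant:
  fixes a :: "nat \<Rightarrow> bool"
  assumes vs: "distinct vs" "set vs = subdiv_verts (gear n l a)"
    and vs': "distinct vs'" "set vs' = subdiv_verts (gear n l a)"
  defines "A \<equiv> op_mat (markov a) vs vs"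
  shows "op_mat (transplant (dual a)) vs vs' * op_mat (transplant a) vs' vs =
    (4 * (1 + w)) \<cdot>\<^sub>m (A * A - 1\<^sub>m (length vs))"
proof -
  have "op_mat (transplant (dual a)) vs vs' * op_mat (transplant a) vs' vs =
      op_mat (\<lambda>f. transplant (dual a) (transplant a f)) vs vs"
    by (rule op_mat_mult) (use assms supported_linear_transplant[of _ "dual a"] in \<open>auto simp: subdiv_verts_dual\<close>)
  also have "\<dots> = op_mat (\<lambda>f v. 4 * (1 + w) * (markov a (markov a f) v - f v)) vs vs"
    by (rule op_mat_cong) (use vs in \<open>auto simp: transplant_transplant\<close>)
  also have "\<dots> = (4 * (1 + w)) \<cdot>\<^sub>m (op_mat (\<lambda>f. markov a (markov a f)) vs vs - 1\<^sub>m (length vs))"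
    using vs(1) by (auto simp: op_mat_def indicator_def nth_eq_iff_index_eq intro!: eq_matI)
  also have "op_mat (\<lambda>f. markov a (markov a f)) vs vs = A * A"
    unfolding A_def using vs by (intro op_mat_mult[symmetric]) (auto simp: supported_linear_markov)
  finally show ?thesis .
qed

lemma isospectral_dual:
  assumes vs: "distinct vs" "set vs = subdiv_verts (gear n l a)"
    and vs': "distinct vs'" "set vs' = subdiv_verts (gear n l a)"
  shows "isospectral (op_mat (markov a) vs vs) (op_mat (markov (dual a)) vs' vs')"
proof -
  let ?A = "op_mat (markov a) vs vs" and ?B = "op_mat (markov (dual a)) vs' vs'"
  let ?C = "op_mat (transplant a) vs' vs" and ?C' = "op_mat (transplant (dual a)) vs vs'"
  have len: "length vs' = length vs"
    using distinct_card[OF vs(1)] distinct_card[OF vs'(1)] vs(2) vs'(2) by simp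
  have carr: "?A \<in> carrier_mat (length vs) (length vs)" "?B \<in> carrier_mat (length vs) (length vs)"
    "?C \<in> carrier_mat (length vs) (length vs)" "?C' \<in> carrier_mat (length vs) (length vs)"
    using op_mat_carrier[of _ vs' vs'] op_mat_carrier[of _ vs' vs] op_mat_carrier[of _ vs vs'] by (auto simp: len)
  have "?B * ?C = op_mat (\<lambda>f. markov (dual a) (transplant a f)) vs' vs"
    by (rule op_mat_mult)
      (use vs' supported_linear_markov[of "dual a"] in \<open>auto simp: subdiv_verts_dual\<close>)
  also have "\<dots> = op_mat (\<lambda>f. transplant a (markov a f)) vs' vs"
    by (rule op_mat_cong) (use vs' in \<open>auto simp: transplant_intertwines\<close>)
  also have "\<dots> = ?C * ?A"
    by (rule op_mat_mult[symmetric]) (use vs vs' in \<open>auto simp: supported_linear_transplant\<close>)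
  finally have inter: "?B * ?C = ?C * ?A" .
  have C'C: "?C' * ?C = (4 * (1 + w)) \<cdot>\<^sub>m (?A * ?A - 1\<^sub>m (length vs))"
    by (rule op_mat_transplant_transplant[OF vs vs'])
  \<comment> \<open>The same identity with the two gears exchanged, as the dual of the dual is the
    original gear.\<close>
  have CC': "?C * ?C' = (4 * (1 + w)) \<cdot>\<^sub>m (?B * ?B - 1\<^sub>m (length vs))"
    using op_mat_transplant_transplant[of vs' "dual a" vs] vs vs' by (simp add: subdiv_verts_dual len)
  show ?thesis
    by (rule isospectral_of_mat_trace_pow_eq[OF carr(1,2)],
        rule mat_trace_pow_eq_of_intertwining[OF carr inter C'C CC'])
      (use w in \<open>auto simp: mat_trace_markov\<close>)
qed

end

theorem theorem2:
  fixes n :: nat and l :: "nat \<Rightarrow> nat" and a :: "nat \<Rightarrow> bool" and w :: real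
    and vs vs' :: "gear_point list"
  assumes "n \<ge> 3"
    and "\<And>i. i < n \<Longrightarrow> l i > 0"
    and "w > 0"
    and "enumerates vs (subdiv_verts (gear n l a))"
    and "enumerates vs' (subdiv_verts (dual_gear n l a))"
  shows "isospectral (markov_matrix (gear n l a) w vs) (markov_matrix (dual_gear n l a) w vs')"
proof -
  interpret gear_data n l w
    by unfold_locales (use assms in auto)
  show ?thesis
    using isospectral_dual[of vs a vs'] assms(4,5)
    by (simp add: enumerates_def dual_gear_def subdiv_verts_dual markov_op_mat)
qed

end
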